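(* Let $\mathcal{S}$ be a structural abstract logic in a propositional language $\mathcal{L}$. If $\mathcal{S}$ is uniform, then its Lindenbaum atlas $\mathbf{Lin}_{\mathcal{S}}[\Sigma_{\mathcal{S}}]$ is uniform.
   Context: $\mathcal{L}$ is an abstract propositional language, given by a set $\mathcal{V}_{\mathcal{L}}$ of variables, a set of constants and a set of finitary connectives. $\mathbf{Fm}_{\mathcal{L}}$ is the set of all $\mathcal{L}$-formulae, also viewed as the formula algebra; $\mathcal{V}(\alpha)$ is the set of variables occurring in $\alpha$, and $\mathcal{V}(X)=\bigcup_{\alpha\in X}\mathcal{V}(\alpha)$ for $X\subseteq\mathbf{Fm}_{\mathcal{L}}$. For $\mathcal{V}\subseteq\mathcal{V}_{\mathcal{L}}$, $\mathbf{Fm}_{\mathcal{L}}[\mathcal{V}]=\{\alpha\in\mathbf{Fm}_{\mathcal{L}} : \mathcal{V}(\alpha)\subseteq\mathcal{V}\}$. A structural abstract logic $\mathcal{S}$ is given by a (not necessarily finitary) consequence relation $\vdash_{\mathcal{S}}$ on $\mathbf{Fm}_{\mathcal{L}}$ (reflexive, monotone, transitive/closed under cut) closed under substitutions, equivalently by its consequence operator $\mathbf{Cn}_{\mathcal{S}}(X)=\{\alpha : X\vdash_{\mathcal{S}}\alpha\}$. An $\mathcal{S}$-theory is a set $X\subseteq\mathbf{Fm}_{\mathcal{L}}$ with $\mathbf{Cn}_{\mathcal{S}}(X)=X$; $\Sigma_{\mathcal{S}}$ is the set of all $\mathcal{S}$-theories. $\mathcal{S}$ is uniform if for all $X,Y\subseteq\mathbf{Fm}_{\mathcal{L}}$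 and $\alpha\in\mathbf{Fm}_{\mathcal{L}}$ such that $\mathcal{V}(X\cup\{\alpha\})\cap\mathcal{V}(Y)=\varnothing$ and $Y$ is consistent (i.e. $\mathbf{Cn}_{\mathcal{S}}(Y)\neq\mathbf{Fm}_{\mathcal{L}}$): $X\cup Y\vdash_{\mathcal{S}}\alpha$ implies $X\vdash_{\mathcal{S}}\alpha$. An $\mathcal{L}$-matrix is a pair $\mathbf{M}=\langle\mathbf{A},D\rangle$ with $\mathbf{A}$ an algebra of the signature of $\mathcal{L}$ and $D\subseteq|\mathbf{A}|$ (its logical filter). A valuation in $\mathbf{A}$ is a homomorphism from the formula algebra to $\mathbf{A}$. $\mathfrak{S}(\mathbf{M})$ is the set of all $X\subseteq\mathbf{Fm}_{\mathcal{L}}$ such that $X=\{\alpha\in\mathbf{Fm}_{\mathcal{L}} : v[\alpha]\in D\}$ for some valuation $v$ in $\mathbf{A}$. A nonempty family of $\mathcal{L}$-matrices is a bundle if its algebras are pairwise isomorphic. An atlas is a pair $\langle\mathbf{A},\{D_i\}_{i\in I}\rangle$ with each $D_i\subseteq|\mathbf{A}|$; its corresponding bundle is $\{\langle\mathbf{A},D_i\rangle\}_{i\in I}$. The Lindenbaum atlas of $\mathcal{S}$ is $\mathbf{Lin}_{\mathcal{S}}[\Sigma_{\mathcal{S}}]=\langle\mathbf{Fm}_{\mathcal{L}},\Sigma_{\mathcal{S}}\rangle$. A bundle $\{\mathbf{M}_i\}_{i\in I}$ is uniform if for all $X,Y\subseteq\mathbf{Fm}_{\mathcal{L}}$ with $X\subseteq\mathbf{Fm}_{\mathcal{L}}[\mathcal{V}_{\mathcal{L}}\setminus\mathcal{V}(Y)]$,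 all $i,j\in I$, all $Z_i\in\mathfrak{S}(\mathbf{M}_i)$ and $Z_j\in\mathfrak{S}(\mathbf{M}_j)$, there are $k\in I$ and $Z_k\in\mathfrak{S}(\mathbf{M}_k)$ such that: if $X\subseteq Z_i$ and $Y\subseteq Z_j\subsetneq\mathbf{Fm}_{\mathcal{L}}$, then $Z_i\cap\mathbf{Fm}_{\mathcal{L}}[\mathcal{V}_{\mathcal{L}}\setminus\mathcal{V}(Y)]=Z_k\cap\mathbf{Fm}_{\mathcal{L}}[\mathcal{V}_{\mathcal{L}}\setminus\mathcal{V}(Y)]$ and $Z_j\cap\mathbf{Fm}_{\mathcal{L}}[\mathcal{V}(Y)]\subseteq Z_k$. An atlas is uniform if its corresponding bundle is uniform. *)

theory Defs
  imports Main
begin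

section \<open>Propositional languages and formulae\<close>

record ('v, 'c, 'f) language =
  Vars :: "'v set"
  Consts :: "'c set"
  Conns :: "'f set"
  arity :: "'f \<Rightarrow> nat"

text \<open>
  Raw formulae. The formulae of a language \<open>L\<close> are those in \<open>Fm L\<close>, which only use symbols of \<open>L\<close>
  and respect the arities. The set function \<open>vars\<close> yields the variables occurring in a formula.
\<close>

datatype (vars: 'v, consts_of: 'c, conns_of: 'f) fm =
  Var 'v | Const 'c | Conn 'f "('v, 'c, 'f) fm list"

inductive_set Fm :: "('v, 'c, 'f) language \<Rightarrow> ('v, 'c, 'f) fm set"
  for L :: "('v, 'c, 'f) language" where
  Var: "x \<in> Vars L \<Longrightarrow> Var x \<in> Fm L"
| Const: "c \<in> Consts L \<Longrightarrow> Const c \<in> Fm L"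
| Conn: "f \<in> Conns L \<Longrightarrow> length as = arity L f \<Longrightarrow> (\<And>a. a \<in> set as \<Longrightarrow> a \<in> Fm L)
    \<Longrightarrow> Conn f as \<in> Fm L"

definition Vs :: "('v, 'c, 'f) fm set \<Rightarrow> 'v set" where
  "Vs X = (\<Union>\<alpha>\<in>X. vars \<alpha>)"

definition Fm_over :: "('v, 'c, 'f) language \<Rightarrow> 'v set \<Rightarrow> ('v, 'c, 'f) fm set" where
  "Fm_over L V = {\<alpha> \<in> Fm L. vars \<alpha> \<subseteq> V}"


section \<open>Algebras of the signature of a language\<close>

record ('a, 'c, 'f) alg =
  universe :: "'a set"
  interp_const :: "'c \<Rightarrow> 'a"
  interp_conn :: "'f \<Rightarrow> 'a list \<Rightarrow> 'a"

text \<open>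
  The universe is not required to be nonempty: \<open>Fm L\<close> is empty when \<open>L\<close> has neither variables nor
  constants nor nullary connectives, and languages are not restricted here.
\<close>

definition is_alg :: "('v, 'c, 'f) language \<Rightarrow> ('a, 'c, 'f) alg \<Rightarrow> bool" where
  "is_alg L A \<longleftrightarrow>
     (\<forall>c\<in>Consts L. interp_const A c \<in> universe A) \<and>
     (\<forall>f\<in>Conns L. \<forall>as. set as \<subseteq> universe A \<and> length as = arity L f
        \<longrightarrow> interp_conn A f as \<in> universe A)"

definition alg_hom ::
  "('v, 'c, 'f) language \<Rightarrow> ('a, 'c, 'f) alg \<Rightarrow> ('b, 'c, 'f) alg \<Rightarrow> ('a \<Rightarrow> 'b) \<Rightarrow> bool" where
  "alg_hom L A B h \<longleftrightarrow>
     h ` universe A \<subseteq> universe B \<and>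
     (\<forall>c\<in>Consts L. h (interp_const A c) = interp_const B c) \<and>
     (\<forall>f\<in>Conns L. \<forall>as. set as \<subseteq> universe A \<and> length as = arity L f
        \<longrightarrow> h (interp_conn A f as) = interp_conn B f (map h as))"

definition alg_isomorphic ::
  "('v, 'c, 'f) language \<Rightarrow> ('a, 'c, 'f) alg \<Rightarrow> ('b, 'c, 'f) alg \<Rightarrow> bool" where
  "alg_isomorphic L A B \<longleftrightarrow> (\<exists>h. alg_hom L A B h \<and> bij_betw h (universe A) (universe B))"

definition fm_alg :: "('v, 'c, 'f) language \<Rightarrow> (('v, 'c, 'f) fm, 'c, 'f) alg" where
  "fm_alg L = \<lparr>universe = Fm L, interp_const = Const, interp_conn = Conn\<rparr>"

definition valuation ::
  "('v, 'c, 'f) language \<Rightarrow> ('a, 'c, 'f) alg \<Rightarrow> (('v, 'c, 'f) fm \<Rightarrow> 'a) \<Rightarrow> bool" where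
  "valuation L A v \<longleftrightarrow> alg_hom L (fm_alg L) A v"

definition substitution ::
  "('v, 'c, 'f) language \<Rightarrow> (('v, 'c, 'f) fm \<Rightarrow> ('v, 'c, 'f) fm) \<Rightarrow> bool" where
  "substitution L \<sigma> \<longleftrightarrow> alg_hom L (fm_alg L) (fm_alg L) \<sigma>"


section \<open>Structural abstract logics\<close>

type_synonym ('v, 'c, 'f) conseq = "('v, 'c, 'f) fm set \<Rightarrow> ('v, 'c, 'f) fm \<Rightarrow> bool"

definition structural_logic :: "('v, 'c, 'f) language \<Rightarrow> ('v, 'c, 'f) conseq \<Rightarrow> bool" where
  "structural_logic L S \<longleftrightarrow>
     (\<forall>X \<alpha>. S X \<alpha> \<longrightarrow> X \<subseteq> Fm L \<and> \<alpha> \<in> Fm L) \<and>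
     (\<forall>X \<alpha>. X \<subseteq> Fm L \<and> \<alpha> \<in> X \<longrightarrow> S X \<alpha>) \<and>
     (\<forall>X Y \<alpha>. X \<subseteq> Y \<and> Y \<subseteq> Fm L \<and> S X \<alpha> \<longrightarrow> S Y \<alpha>) \<and>
     (\<forall>X Y \<alpha>. X \<subseteq> Fm L \<and> (\<forall>\<beta>\<in>Y. S X \<beta>) \<and> S Y \<alpha> \<longrightarrow> S X \<alpha>) \<and>
     (\<forall>X \<alpha> \<sigma>. substitution L \<sigma> \<and> S X \<alpha> \<longrightarrow> S (\<sigma> ` X) (\<sigma> \<alpha>))"

definition Cn :: "('v, 'c, 'f) conseq \<Rightarrow> ('v, 'c, 'f) fm set \<Rightarrow> ('v, 'c, 'f) fm set" where
  "Cn S X = {\<alpha>. S X \<alpha>}"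

definition theories ::
  "('v, 'c, 'f) language \<Rightarrow> ('v, 'c, 'f) conseq \<Rightarrow> ('v, 'c, 'f) fm set set" where
  "theories L S = {X. X \<subseteq> Fm L \<and> Cn S X = X}"

definition consistent ::
  "('v, 'c, 'f) language \<Rightarrow> ('v, 'c, 'f) conseq \<Rightarrow> ('v, 'c, 'f) fm set \<Rightarrow> bool" where
  "consistent L S Y \<longleftrightarrow> Cn S Y \<noteq> Fm L"

definition uniform_logic :: "('v, 'c, 'f) language \<Rightarrow> ('v, 'c, 'f) conseq \<Rightarrow> bool" where
  "uniform_logic L S \<longleftrightarrow>
     (\<forall>X Y \<alpha>. X \<subseteq> Fm L \<and> Y \<subseteq> Fm L \<and> \<alpha> \<in> Fm L \<and> Vs (X \<union> {\<alpha>}) \<inter> Vs Y = {} \<and> consistent L S Y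
        \<longrightarrow> S (X \<union> Y) \<alpha> \<longrightarrow> S X \<alpha>)"


section \<open>Matrices, bundles and atlases\<close>

record ('a, 'c, 'f) matrix =
  alg_of :: "('a, 'c, 'f) alg"
  filter_of :: "'a set"

definition is_matrix :: "('v, 'c, 'f) language \<Rightarrow> ('a, 'c, 'f) matrix \<Rightarrow> bool" where
  "is_matrix L M \<longleftrightarrow> is_alg L (alg_of M) \<and> filter_of M \<subseteq> universe (alg_of M)"

definition matrix_sets ::
  "('v, 'c, 'f) language \<Rightarrow> ('a, 'c, 'f) matrix \<Rightarrow> ('v, 'c, 'f) fm set set" where
  "matrix_sets L M = {{\<alpha> \<in> Fm L. v \<alpha> \<in> filter_of M} |v. valuation L (alg_of M) v}"

definition is_bundle ::
  "('v, 'c, 'f) language \<Rightarrow> 'i set \<Rightarrow> ('i \<Rightarrow> ('a, 'c, 'f) matrix) \<Rightarrow> bool" where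
  "is_bundle L I M \<longleftrightarrow>
     I \<noteq> {} \<and> (\<forall>i\<in>I. is_matrix L (M i)) \<and>
     (\<forall>i\<in>I. \<forall>j\<in>I. alg_isomorphic L (alg_of (M i)) (alg_of (M j)))"

definition uniform_bundle ::
  "('v, 'c, 'f) language \<Rightarrow> 'i set \<Rightarrow> ('i \<Rightarrow> ('a, 'c, 'f) matrix) \<Rightarrow> bool" where
  "uniform_bundle L I M \<longleftrightarrow>
     is_bundle L I M \<and>
     (\<forall>X Y. X \<subseteq> Fm L \<and> Y \<subseteq> Fm L \<and> X \<subseteq> Fm_over L (Vars L - Vs Y) \<longrightarrow>
       (\<forall>i\<in>I. \<forall>j\<in>I. \<forall>Zi\<in>matrix_sets L (M i). \<forall>Zj\<in>matrix_sets L (M j).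
         \<exists>k\<in>I. \<exists>Zk\<in>matrix_sets L (M k).
           X \<subseteq> Zi \<and> Y \<subseteq> Zj \<and> Zj \<subset> Fm L \<longrightarrow>
             Zi \<inter> Fm_over L (Vars L - Vs Y) = Zk \<inter> Fm_over L (Vars L - Vs Y) \<and>
             Zj \<inter> Fm_over L (Vs Y) \<subseteq> Zk))"

record ('i, 'a, 'c, 'f) atlas =
  atlas_alg :: "('a, 'c, 'f) alg"
  atlas_index :: "'i set"
  atlas_filter :: "'i \<Rightarrow> 'a set"

definition atlas_matrix :: "('i, 'a, 'c, 'f) atlas \<Rightarrow> 'i \<Rightarrow> ('a, 'c, 'f) matrix" where
  "atlas_matrix At i = \<lparr>alg_of = atlas_alg At, filter_of = atlas_filter At i\<rparr>"

definition uniform_atlas :: "('v, 'c, 'f) language \<Rightarrow> ('i, 'a, 'c, 'f) atlas \<Rightarrow> bool" where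
  "uniform_atlas L At \<longleftrightarrow> uniform_bundle L (atlas_index At) (atlas_matrix At)"

text \<open>The family of all theories is indexed by itself.\<close>

definition Lindenbaum_atlas ::
  "('v, 'c, 'f) language \<Rightarrow> ('v, 'c, 'f) conseq
    \<Rightarrow> (('v, 'c, 'f) fm set, ('v, 'c, 'f) fm, 'c, 'f) atlas" where
  "Lindenbaum_atlas L S =
     \<lparr>atlas_alg = fm_alg L, atlas_index = theories L S, atlas_filter = (\<lambda>T. T)\<rparr>"

end

theory Submission
  imports Defs
begin

text \<open>
  Since substitutions pull theories back to theories, the sets witnessed by the Lindenbaum atlas are
  exactly the theories. Given theories \<open>Zi\<close> and \<open>Zj \<noteq> Fm L\<close>, let \<open>Zk\<close> be the theory generated by the
  part of \<open>Zi\<close> avoiding the variables of \<open>Y\<close> and the part of \<open>Zj\<close> using only these variables. The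
  latter part is consistent, so by uniformity it adds no consequences in the remaining variables.
\<close>

lemma
  assumes "structural_logic L S"
  shows structural_logic_conclusion: "S X \<alpha> \<Longrightarrow> \<alpha> \<in> Fm L"
    and structural_logic_refl: "X \<subseteq> Fm L \<Longrightarrow> \<alpha> \<in> X \<Longrightarrow> S X \<alpha>"
    and structural_logic_mono: "S X \<alpha> \<Longrightarrow> X \<subseteq> X' \<Longrightarrow> X' \<subseteq> Fm L \<Longrightarrow> S X' \<alpha>"
    and structural_logic_cut: "X \<subseteq> Fm L \<Longrightarrow> (\<And>\<beta>. \<beta> \<in> Y \<Longrightarrow> S X \<beta>) \<Longrightarrow> S Y \<alpha> \<Longrightarrow> S X \<alpha>"
    and structural_logic_subst: "substitution L \<sigma> \<Longrightarrow> S X \<alpha> \<Longrightarrow> S (\<sigma> ` X) (\<sigma> \<alpha>)"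
  using assms unfolding structural_logic_def by metis+

lemma theories_iff:
  assumes "structural_logic L S"
  shows "T \<in> theories L S \<longleftrightarrow> T \<subseteq> Fm L \<and> (\<forall>\<alpha>. S T \<alpha> \<longrightarrow> \<alpha> \<in> T)"
  using structural_logic_refl[OF assms, of T] by (auto simp: theories_def Cn_def)

text \<open>This makes the index set of the Lindenbaum atlas nonempty, as a bundle requires.\<close>

lemma Fm_in_theories:
  assumes "structural_logic L S"
  shows "Fm L \<in> theories L S"
  using structural_logic_conclusion[OF assms] by (auto simp: theories_iff[OF assms])

lemma Cn_in_theories:
  assumes S: "structural_logic L S" and X: "X \<subseteq> Fm L"
  shows "Cn S X \<in> theories L S"
proof -
  have "S X \<alpha>" if "S (Cn S X) \<alpha>" for \<alpha>
    using structural_logic_cut[OF S X _ that] by (simp add: Cn_def)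
  then show ?thesis
    using structural_logic_conclusion[OF S] by (auto simp: theories_iff[OF S] Cn_def)
qed

lemma Cn_subset_theory:
  assumes S: "structural_logic L S" and T: "T \<in> theories L S" and "X \<subseteq> T"
  shows "Cn S X \<subseteq> T"
  using assms structural_logic_mono[OF S, of X _ T] by (auto simp: theories_iff[OF S] Cn_def)

lemma is_alg_fm_alg: "is_alg L (fm_alg L)"
  by (auto simp: is_alg_def fm_alg_def intro!: Fm.intros)

text \<open>The identity serves twice: as the isomorphism between the equal algebras of the bundle,
  and as the valuation that exhibits a theory as one of its own matrix sets.\<close>

lemma alg_hom_id: "alg_hom L A A (\<lambda>x. x)"
  by (auto simp: alg_hom_def)

lemma alg_isomorphic_refl: "alg_isomorphic L A A"
  unfolding alg_isomorphic_def using alg_hom_id bij_betw_id[unfolded id_def] by blast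

text \<open>Structurality sends a consequence \<alpha> of the preimage to a consequence \<sigma>
  \<alpha> of its image. That image lies in the theory \<open>T\<close>, hence so does \<sigma>
  \<alpha>.\<close>

lemma substitution_vimage_in_theories:
  assumes S: "structural_logic L S" and T: "T \<in> theories L S" and \<sigma>: "substitution L \<sigma>"
  shows "{\<alpha> \<in> Fm L. \<sigma> \<alpha> \<in> T} \<in> theories L S"
proof -
  have "\<sigma> \<alpha> \<in> T" if "S {\<alpha> \<in> Fm L. \<sigma> \<alpha> \<in> T} \<alpha>" for \<alpha>
    using Cn_subset_theory[OF S T, of "\<sigma> ` {\<alpha> \<in> Fm L. \<sigma> \<alpha> \<in> T}"]
      structural_logic_subst[OF S \<sigma> that]
    by (auto simp: Cn_def)
  then show ?thesis
    using structural_logic_conclusion[OF S] by (auto simp: theories_iff[OF S])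
qed

text \<open>A valuation in the formula algebra is a substitution, so every matrix set is the
  preimage of a theory under a substitution.\<close>

lemma matrix_sets_Lindenbaum_subset:
  assumes "structural_logic L S" and "T \<in> theories L S"
  shows "matrix_sets L (atlas_matrix (Lindenbaum_atlas L S) T) \<subseteq> theories L S"
  using substitution_vimage_in_theories[OF assms]
  by (auto simp: matrix_sets_def atlas_matrix_def Lindenbaum_atlas_def valuation_def
      substitution_def)

lemma theory_in_matrix_sets_Lindenbaum:
  assumes "T \<in> theories L S"
  shows "T \<in> matrix_sets L (atlas_matrix (Lindenbaum_atlas L S) T)"
proof -
  have "T = {\<alpha> \<in> Fm L. \<alpha> \<in> T}"
    using assms by (auto simp: theories_def)
  moreover have "valuation L (fm_alg L) (\<lambda>\<alpha>. \<alpha>)"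
    unfolding valuation_def by (rule alg_hom_id)
  ultimately show ?thesis
    unfolding matrix_sets_def atlas_matrix_def Lindenbaum_atlas_def by fastforce
qed

lemma is_bundle_Lindenbaum:
  assumes "structural_logic L S"
  shows "is_bundle L (theories L S) (atlas_matrix (Lindenbaum_atlas L S))"
proof -
  have "T \<subseteq> universe (fm_alg L)" if "T \<in> theories L S" for T
    using that by (simp add: theories_def fm_alg_def)
  then show ?thesis
    using Fm_in_theories[OF assms]
    by (auto simp: is_bundle_def is_matrix_def atlas_matrix_def Lindenbaum_atlas_def
        is_alg_fm_alg alg_isomorphic_refl)
qed

text \<open>The core of the argument, with the two sets of variables abstracted to disjoint
  \<open>V\<close> and \<open>W\<close>. The witness is \<open>Cn S (P \<union> Q)\<close> for the
  restrictions \<open>P\<close> and \<open>Q\<close> defined below.\<close>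

lemma uniform_logic_amalgamation:
  assumes S: "structural_logic L S" and unif: "uniform_logic L S"
    and Z: "Z \<in> theories L S" and Z': "Z' \<in> theories L S" "Z' \<subset> Fm L" and VW: "V \<inter> W = {}"
  shows "\<exists>T\<in>theories L S. Z \<inter> Fm_over L V = T \<inter> Fm_over L V \<and> Z' \<inter> Fm_over L W \<subseteq> T"
proof -
  define P where "P = Z \<inter> Fm_over L V"
  define Q where "Q = Z' \<inter> Fm_over L W"
  have sub: "P \<subseteq> Fm L" "Q \<subseteq> Fm L"
    by (auto simp: P_def Q_def Fm_over_def)
  \<comment> \<open>As \<open>Q\<close> lies in the theory \<open>Z'\<close>, its consequences stay
    within a proper subset of \<open>Fm L\<close>; this is the consistency that uniformity asks
    for.\<close>
  have "Cn S Q \<subseteq> Z'"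
    using Cn_subset_theory[OF S Z'(1)] by (simp add: Q_def)
  with Z'(2) have cons: "consistent L S Q"
    by (auto simp: consistent_def)
  \<comment> \<open>Uniformity discards \<open>Q\<close>, and what follows from \<open>P\<close>
    alone is already in the theory \<open>Z\<close>. This is the nontrivial inclusion of the
    required equality.\<close>
  have "\<alpha> \<in> Z" if \<alpha>: "S (P \<union> Q) \<alpha>" "\<alpha> \<in> Fm_over L V" for \<alpha>
  proof -
    have "Vs (P \<union> {\<alpha>}) \<subseteq> V" "Vs Q \<subseteq> W"
      using \<alpha>(2) by (auto simp: P_def Q_def Vs_def Fm_over_def)
    then have "Vs (P \<union> {\<alpha>}) \<inter> Vs Q = {}"
      using VW by blast
    moreover have "\<alpha> \<in> Fm L"
      using \<alpha>(2) by (simp add: Fm_over_def)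
    ultimately have "S P \<alpha>"
      using unif sub cons \<alpha>(1) unfolding uniform_logic_def by blast
    then show ?thesis
      using Cn_subset_theory[OF S Z, of P] by (auto simp: P_def Cn_def)
  qed
  moreover have "P \<union> Q \<subseteq> Cn S (P \<union> Q)"
    using structural_logic_refl[OF S, of "P \<union> Q"] sub by (auto simp: Cn_def)
  ultimately have "Z \<inter> Fm_over L V = Cn S (P \<union> Q) \<inter> Fm_over L V" "Q \<subseteq> Cn S (P \<union> Q)"
    by (auto simp: P_def Cn_def)
  then show ?thesis
    using Cn_in_theories[OF S, of "P \<union> Q"] sub by (auto simp: Q_def)
qed

theorem proposition2p2:
  fixes L :: "('v, 'c, 'f) language"
    and S :: "('v, 'c, 'f) conseq"
  assumes "structural_logic L S"
    and "uniform_logic L S"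
  shows "uniform_atlas L (Lindenbaum_atlas L S)"
proof -
  let ?M = "atlas_matrix (Lindenbaum_atlas L S)"
  have "\<exists>k\<in>theories L S. \<exists>Zk\<in>matrix_sets L (?M k).
      X \<subseteq> Zi \<and> Y \<subseteq> Zj \<and> Zj \<subset> Fm L \<longrightarrow>
        Zi \<inter> Fm_over L (Vars L - Vs Y) = Zk \<inter> Fm_over L (Vars L - Vs Y) \<and>
        Zj \<inter> Fm_over L (Vs Y) \<subseteq> Zk"
    if ij: "i \<in> theories L S" "j \<in> theories L S"
      and "Zi \<in> matrix_sets L (?M i)" "Zj \<in> matrix_sets L (?M j)" for X Y i j Zi Zj
  proof -
    have Z: "Zi \<in> theories L S" "Zj \<in> theories L S"
      using that matrix_sets_Lindenbaum_subset[OF assms(1)] by auto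
    \<comment> \<open>The witness is quantified outside the implication, so one is needed even if
      \<open>Zj\<close> is all of \<open>Fm L\<close>; then any theory will do.\<close>
    have "\<exists>T\<in>theories L S. Zj \<subset> Fm L \<longrightarrow>
        Zi \<inter> Fm_over L (Vars L - Vs Y) = T \<inter> Fm_over L (Vars L - Vs Y) \<and>
        Zj \<inter> Fm_over L (Vs Y) \<subseteq> T"
    proof (cases "Zj \<subset> Fm L")
      case True
      show ?thesis
        using uniform_logic_amalgamation[OF assms Z True, of "Vars L - Vs Y" "Vs Y"] by auto
    qed (use Z in auto)
    then obtain T where "T \<in> theories L S" and "Zj \<subset> Fm L \<longrightarrow>
        Zi \<inter> Fm_over L (Vars L - Vs Y) = T \<inter> Fm_over L (Vars L - Vs Y) \<and>
        Zj \<inter> Fm_over L (Vs Y) \<subseteq> T"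
      by (rule bexE)
    then show ?thesis
      \<comment> \<open>\<open>T\<close> is both the index \<open>k\<close> and the set
        \<open>Zk\<close>, since theories index themselves.\<close>
      by (intro bexI[of _ T] bexI[of _ T]) (auto intro: theory_in_matrix_sets_Lindenbaum)
  qed
  moreover have "atlas_index (Lindenbaum_atlas L S) = theories L S"
    by (simp add: Lindenbaum_atlas_def)
  ultimately show ?thesis
    using is_bundle_Lindenbaum[OF assms(1)]
    unfolding uniform_atlas_def uniform_bundle_def by simp
qed

end
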